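(* Let $G$ be a compact abelian topological group, let $f:G\to G$ be a continuous endomorphism with the shadowing property, and let $H$ be a closed $f$-invariant subgroup of $G$. Then the canonical mapping $\tilde f:G/H\to G/H$ has the shadowing property.
   Context: For a topological group $G$ with identity $e$, $\mathfrak{B}_e$ is a fundamental system of symmetric neighborhoods of $e$. Let $g$ be a continuous endomorphism of $G$ and $D,E\in\mathfrak{B}_e$. A $D$-pseudo-orbit of $g$ is a sequence $(x_n)_{n\ge 0}$ in $G$ with $g(x_n)x_{n+1}^{-1}\in D$ for all $n\ge 0$. It is $E$-shadowed by $x\in G$ if $g^n(x)x_n^{-1}\in E$ for all $n\ge 0$. The map $g$ has the shadowing property if for every $E\in\mathfrak{B}_e$ there is $D\in\mathfrak{B}_e$ such that every $D$-pseudo-orbit of $g$ is $E$-shadowed by some point of $G$. A subgroup $H$ is $f$-invariant if $f(H)\subseteq H$. $G/H$ is the quotient topological group with projection $\pi:G\to G/H$, the sets $\pi(E)$, $E\in\mathfrak{B}_e$, serve as the fundamental system of symmetric neighborhoods of its identity, and the canonical mapping is $\tilde f(xH)=f(x)H$. *)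

theory Defs
  imports "HOL-Analysis.Analysis" "HOL-Algebra.Coset"
begin

text \<open>No separation axiom is imposed on topological groups.\<close>

locale topological_group = group G for G (structure) +
  fixes T :: "'a topology"
  assumes topspace_eq: "topspace T = carrier G"
    and continuous_mult: "continuous_map (prod_topology T T) T (\<lambda>(x, y). x \<otimes> y)"
    and continuous_inv: "continuous_map T T (\<lambda>x. inv x)"

text \<open>The members are neighborhoods of the identity in the wide sense: they need not be open.\<close>

definition fundamental_system ::
    "('a, 'b) monoid_scheme \<Rightarrow> 'a topology \<Rightarrow> 'a set set \<Rightarrow> bool" where
  "fundamental_system G T \<B> \<longleftrightarrow>
     (\<forall>E\<in>\<B>. E \<subseteq> carrier G \<and> (\<exists>U. openin T U \<and> \<one>\<^bsub>G\<^esub> \<in> U \<and> U \<subseteq> E)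
            \<and> (\<lambda>x. inv\<^bsub>G\<^esub> x) ` E = E) \<and>
     neighbourhood_base_at \<one>\<^bsub>G\<^esub> (\<lambda>E. E \<in> \<B>) T"

definition continuous_endomorphism ::
    "('a, 'b) monoid_scheme \<Rightarrow> 'a topology \<Rightarrow> ('a \<Rightarrow> 'a) \<Rightarrow> bool" where
  "continuous_endomorphism G T g \<longleftrightarrow> g \<in> hom G G \<and> continuous_map T T g"

definition pseudo_orbit ::
    "('a, 'b) monoid_scheme \<Rightarrow> ('a \<Rightarrow> 'a) \<Rightarrow> 'a set \<Rightarrow> (nat \<Rightarrow> 'a) \<Rightarrow> bool" where
  "pseudo_orbit G g D x \<longleftrightarrow>
     (\<forall>n. x n \<in> carrier G) \<and> (\<forall>n. g (x n) \<otimes>\<^bsub>G\<^esub> inv\<^bsub>G\<^esub> (x (Suc n)) \<in> D)"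

definition shadowed_by ::
    "('a, 'b) monoid_scheme \<Rightarrow> ('a \<Rightarrow> 'a) \<Rightarrow> 'a set \<Rightarrow> (nat \<Rightarrow> 'a) \<Rightarrow> 'a \<Rightarrow> bool" where
  "shadowed_by G g E x p \<longleftrightarrow> (\<forall>n. (g ^^ n) p \<otimes>\<^bsub>G\<^esub> inv\<^bsub>G\<^esub> (x n) \<in> E)"

text \<open>The shadowing property is a property of a continuous endomorphism of a topological group
  with a chosen fundamental system \<open>\<B>\<close>. The first three conjuncts record this setting, so that a
  claim of the property for a quotient includes that the quotient data form such a setting.\<close>

definition shadowing_property ::
    "('a, 'b) monoid_scheme \<Rightarrow> 'a topology \<Rightarrow> 'a set set \<Rightarrow> ('a \<Rightarrow> 'a) \<Rightarrow> bool" where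
  "shadowing_property G T \<B> g \<longleftrightarrow>
     topological_group G T \<and> fundamental_system G T \<B> \<and> continuous_endomorphism G T g \<and>
     (\<forall>E\<in>\<B>. \<exists>D\<in>\<B>. \<forall>x. pseudo_orbit G g D x \<longrightarrow> (\<exists>p\<in>carrier G. shadowed_by G g E x p))"

text \<open>\<open>G Mod H\<close> consists of right cosets; for abelian \<open>G\<close> these are the cosets \<open>xH\<close>.\<close>

definition quotient_proj :: "('a, 'b) monoid_scheme \<Rightarrow> 'a set \<Rightarrow> 'a \<Rightarrow> 'a set" where
  "quotient_proj G H x = H #>\<^bsub>G\<^esub> x"

definition quotient_topology ::
    "('a, 'b) monoid_scheme \<Rightarrow> 'a topology \<Rightarrow> 'a set \<Rightarrow> 'a set topology" where
  "quotient_topology G T H =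
     topology (\<lambda>\<U>. \<U> \<subseteq> carrier (G Mod H) \<and>
                   openin T {x \<in> topspace T. quotient_proj G H x \<in> \<U>})"

definition quotient_system ::
    "('a, 'b) monoid_scheme \<Rightarrow> 'a set \<Rightarrow> 'a set set \<Rightarrow> 'a set set set" where
  "quotient_system G H \<B> = (\<lambda>E. quotient_proj G H ` E) ` \<B>"

text \<open>The value at a coset \<open>C\<close> is the common value of \<open>f(x)H\<close> for \<open>x \<in> C\<close>.\<close>

definition canonical_map ::
    "('a, 'b) monoid_scheme \<Rightarrow> 'a set \<Rightarrow> ('a \<Rightarrow> 'a) \<Rightarrow> 'a set \<Rightarrow> 'a set" where
  "canonical_map G H f C = the_elem ((\<lambda>x. quotient_proj G H (f x)) ` C)"

lemma openin_quotient_topology: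
  "openin (quotient_topology G T H) \<U> \<longleftrightarrow>
     \<U> \<subseteq> carrier (G Mod H) \<and> openin T {x \<in> topspace T. quotient_proj G H x \<in> \<U>}"
proof -
  have "istopology (\<lambda>\<U>. \<U> \<subseteq> carrier (G Mod H) \<and>
          openin T {x \<in> topspace T. quotient_proj G H x \<in> \<U>})" (is "istopology ?P")
    unfolding istopology_def
  proof (intro conjI allI impI)
    fix S S' assume "?P S" "?P S'"
    moreover have "{x \<in> topspace T. quotient_proj G H x \<in> S \<inter> S'} =
      {x \<in> topspace T. quotient_proj G H x \<in> S} \<inter> {x \<in> topspace T. quotient_proj G H x \<in> S'}"
      by blast
    ultimately show "S \<inter> S' \<subseteq> carrier (G Mod H)"
      and "openin T {x \<in> topspace T. quotient_proj G H x \<in> S \<inter> S'}" by auto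
  next
    fix \<K> assume *: "\<forall>K\<in>\<K>. ?P K"
    then show "\<Union>\<K> \<subseteq> carrier (G Mod H)" by blast
    have "{x \<in> topspace T. quotient_proj G H x \<in> \<Union>\<K>} =
      (\<Union>K\<in>\<K>. {x \<in> topspace T. quotient_proj G H x \<in> K})" by blast
    then show "openin T {x \<in> topspace T. quotient_proj G H x \<in> \<Union>\<K>}"
      using * by auto
  qed
  then show ?thesis
    unfolding quotient_topology_def by (simp only: topology_inverse')
qed

lemma quotient_map_quotient_proj:
  assumes "topspace T = carrier G"
  shows "quotient_map T (quotient_topology G T H) (quotient_proj G H)"
proof -
  have im: "quotient_proj G H ` topspace T = carrier (G Mod H)"
    using assms by (auto simp: quotient_proj_def FactGroup_def RCOSETS_def)
  then have "{x \<in> topspace T. quotient_proj G H x \<in> carrier (G Mod H)} = topspace T" by blast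
  then have "openin (quotient_topology G T H) (carrier (G Mod H))"
    by (simp add: openin_quotient_topology)
  then have "topspace (quotient_topology G T H) = carrier (G Mod H)"
    by (metis openin_quotient_topology openin_subset openin_topspace subset_antisym)
  with im show ?thesis
    by (simp add: quotient_map_def openin_quotient_topology)
qed

lemma canonical_map_quotient_proj:
  assumes "comm_group G" "subgroup H G" "f \<in> hom G G" "f ` H \<subseteq> H" "x \<in> carrier G"
  shows "canonical_map G H f (quotient_proj G H x) = quotient_proj G H (f x)"
proof -
  interpret comm_group G by fact
  interpret H: subgroup H G by fact
  have fx: "f x \<in> carrier G" using assms(3,5) by (auto simp: hom_def)
  have "quotient_proj G H (f y) = quotient_proj G H (f x)" if y: "y \<in> quotient_proj G H x" for y
  proof -
    obtain h where h: "h \<in> H" "y = h \<otimes>\<^bsub>G\<^esub> x" using y by (auto simp: quotient_proj_def r_coset_def)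
    then have "f y = f h \<otimes>\<^bsub>G\<^esub> f x" using assms(3,5) by (simp add: hom_def)
    moreover have "f h \<in> H" using assms(4) h by blast
    moreover have "H #>\<^bsub>G\<^esub> (f h \<otimes>\<^bsub>G\<^esub> f x) = H #>\<^bsub>G\<^esub> f x" if "f h \<in> H"
    proof -
      have "H #>\<^bsub>G\<^esub> f h = H"
        using that H.subgroup_axioms by (intro coset_join2) auto
      then show ?thesis
        using coset_mult_assoc[OF H.subset H.mem_carrier[OF that] fx] by simp
    qed
    ultimately show ?thesis
      by (simp add: quotient_proj_def)
  qed
  moreover have "x \<in> quotient_proj G H x"
    using assms(2,5) by (simp add: quotient_proj_def rcos_self)
  ultimately have "(\<lambda>y. quotient_proj G H (f y)) ` quotient_proj G H x = {quotient_proj G H (f x)}"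
    by blast
  then show ?thesis by (simp add: canonical_map_def)
qed

end

theory Submission
  imports Defs
begin

text \<open>
  The reason is that pseudo-orbits lift through surjective homomorphisms without any loss. Suppose
  \<open>p\<close> is a surjective homomorphism with \<open>p \<circ> f = g \<circ> p\<close> and \<open>y\<close> is a \<open>p(D)\<close>-pseudo-orbit of \<open>g\<close>.
  Choose \<open>d\<^sub>n \<in> D\<close> with \<open>p(d\<^sub>n) = g(y\<^sub>n) y\<^sub>n\<^sub>+\<^sub>1\<inverse>\<close>, start from any \<open>x\<^sub>0\<close> over \<open>y\<^sub>0\<close> and put
  \<open>x\<^sub>n\<^sub>+\<^sub>1 = d\<^sub>n\<inverse> f(x\<^sub>n)\<close>. Then \<open>x\<close> lies over \<open>y\<close> and its errors are exactly the \<open>d\<^sub>n\<close>, so it is a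
  \<open>D\<close>-pseudo-orbit of \<open>f\<close> (\<open>pseudo_orbit_lift\<close>). A point that \<open>E\<close>-shadows \<open>x\<close> projects to one that
  \<open>p(E)\<close>-shadows \<open>y\<close>; thus the neighborhood \<open>D\<close> that \<open>f\<close> provides for \<open>E\<close> yields the neighborhood
  \<open>p(D)\<close> that \<open>g\<close> needs for \<open>p(E)\<close>.

  What remains is that the quotient data form a legitimate setting. The projection \<open>G \<rightarrow> G/H\<close> is open,
  because the saturation of an open set is a union of translates (\<open>open_map_quotient_proj\<close>). For an
  open continuous surjective homomorphism, the group topology, the fundamental system of the
  identity and the continuity of the endomorphism all pass to the image.
\<close>

section \<open>Open continuous epimorphisms\<close>

lemma open_map_prod_top:
  assumes f: "open_map X X' f" and g: "open_map Y Y' g"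
  shows "open_map (prod_topology X Y) (prod_topology X' Y') (\<lambda>(x, y). (f x, g y))"
  unfolding open_map_def
proof (intro allI impI)
  fix W assume W: "openin (prod_topology X Y) W"
  show "openin (prod_topology X' Y') ((\<lambda>(x, y). (f x, g y)) ` W)"
    unfolding openin_prod_topology_alt
  proof (intro allI impI)
    fix a b assume "(a, b) \<in> (\<lambda>(x, y). (f x, g y)) ` W"
    then obtain x y where xy: "(x, y) \<in> W" "a = f x" "b = g y" by auto
    obtain U V where UV: "openin X U" "openin Y V" "x \<in> U" "y \<in> V" "U \<times> V \<subseteq> W"
      using W xy(1) unfolding openin_prod_topology_alt by meson
    show "\<exists>U V. openin X' U \<and> openin Y' V \<and> a \<in> U \<and> b \<in> V \<and>
            U \<times> V \<subseteq> (\<lambda>(x, y). (f x, g y)) ` W"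
    proof (intro exI conjI)
      show "openin X' (f ` U)" "openin Y' (g ` V)"
        using f g UV by (simp_all add: open_map_def)
      show "a \<in> f ` U" "b \<in> g ` V" using xy UV by auto
      show "f ` U \<times> g ` V \<subseteq> (\<lambda>(x, y). (f x, g y)) ` W" using UV(5) by force
    qed
  qed
qed

locale open_epimorphism = group_hom G K p + topological_group G T
  for G (structure) and K (structure) and p and T +
  fixes S
  assumes open_hom: "open_map T S p"
    and continuous_hom: "continuous_map T S p"
    and image_eq: "p ` carrier G = carrier K"
    and topspace_image: "topspace S = carrier K"
begin

lemma quotient_map_hom: "quotient_map T S p"
  using continuous_open_imp_quotient_map[OF continuous_hom open_hom]
  by (simp add: topspace_eq topspace_image image_eq)

text \<open>Continuity of the multiplication on \<open>K\<close> is tested after composing with \<open>p \<times> p\<close>; this map is a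
  quotient map because \<open>p\<close> is open.\<close>

lemma topological_group_image: "topological_group K S"
proof -
  let ?pp = "\<lambda>(x, y). (p x, p y)"
  have "continuous_map (prod_topology T T) (prod_topology S S) ?pp"
    using continuous_hom by (intro continuous_map_prod_top[THEN iffD2]) simp
  moreover have "open_map (prod_topology T T) (prod_topology S S) ?pp"
    by (rule open_map_prod_top[OF open_hom open_hom])
  moreover have "?pp ` topspace (prod_topology T T) = topspace (prod_topology S S)"
    unfolding topspace_prod_topology topspace_eq topspace_image image_eq[symmetric] by force
  ultimately have pp: "quotient_map (prod_topology T T) (prod_topology S S) ?pp"
    by (rule continuous_open_imp_quotient_map)
  have "continuous_map (prod_topology T T) S (p \<circ> (\<lambda>(x, y). x \<otimes> y))"
    by (rule continuous_map_compose[OF continuous_mult continuous_hom])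
  then have "continuous_map (prod_topology T T) S ((\<lambda>(x, y). x \<otimes>\<^bsub>K\<^esub> y) \<circ> ?pp)"
    by (rule continuous_map_eq) (auto simp: topspace_eq)
  then have mult: "continuous_map (prod_topology S S) S (\<lambda>(x, y). x \<otimes>\<^bsub>K\<^esub> y)"
    using continuous_compose_quotient_map_eq[OF pp] by blast
  have "continuous_map T S (p \<circ> (\<lambda>x. inv x))"
    by (rule continuous_map_compose[OF continuous_inv continuous_hom])
  then have "continuous_map T S ((\<lambda>y. inv\<^bsub>K\<^esub> y) \<circ> p)"
    by (rule continuous_map_eq) (auto simp: topspace_eq)
  then have "continuous_map S S (\<lambda>y. inv\<^bsub>K\<^esub> y)"
    using continuous_compose_quotient_map_eq[OF quotient_map_hom] by blast
  with mult show ?thesis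
    by (intro topological_group.intro topological_group_axioms.intro H.group_axioms topspace_image)
qed

lemma fundamental_system_image:
  assumes "fundamental_system G T \<B>"
  shows "fundamental_system K S ((`) p ` \<B>)"
  unfolding fundamental_system_def
proof (intro conjI ballI)
  fix F assume "F \<in> (`) p ` \<B>"
  then obtain E where E: "E \<in> \<B>" "F = p ` E" by blast
  have EG: "E \<subseteq> carrier G" and sym: "(\<lambda>x. inv x) ` E = E"
    and "\<exists>U. openin T U \<and> \<one> \<in> U \<and> U \<subseteq> E"
    using assms E(1) unfolding fundamental_system_def by simp_all
  then obtain U where U: "openin T U" "\<one> \<in> U" "U \<subseteq> E" by blast
  show "F \<subseteq> carrier K" using E EG by auto
  show "\<exists>V. openin S V \<and> \<one>\<^bsub>K\<^esub> \<in> V \<and> V \<subseteq> F"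
  proof (intro exI conjI)
    show "openin S (p ` U)" using open_hom U by (simp add: open_map_def)
    show "\<one>\<^bsub>K\<^esub> \<in> p ` U" using U hom_one by (metis imageI)
    show "p ` U \<subseteq> F" using E U by blast
  qed
  have "(\<lambda>y. inv\<^bsub>K\<^esub> y) ` p ` E = p ` (\<lambda>x. inv x) ` E"
    unfolding image_image using EG by (intro image_cong) auto
  then show "(\<lambda>y. inv\<^bsub>K\<^esub> y) ` F = F" using E sym by simp
next
  show "neighbourhood_base_at \<one>\<^bsub>K\<^esub> (\<lambda>F. F \<in> (`) p ` \<B>) S"
    unfolding neighbourhood_base_at_def
  proof (intro allI impI, elim conjE)
    fix W assume W: "openin S W" "\<one>\<^bsub>K\<^esub> \<in> W"
    let ?W = "{x \<in> topspace T. p x \<in> W}"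
    have "openin T ?W" "\<one> \<in> ?W"
      using openin_continuous_map_preimage[OF continuous_hom W(1)] W(2) by (auto simp: topspace_eq)
    then obtain U E where U: "openin T U" "E \<in> \<B>" "\<one> \<in> U" "U \<subseteq> E" "E \<subseteq> ?W"
      using assms unfolding fundamental_system_def neighbourhood_base_at_def by meson
    have "openin S (p ` U)" using open_hom U by (simp add: open_map_def)
    moreover have "\<one>\<^bsub>K\<^esub> \<in> p ` U" using U hom_one by (metis imageI)
    moreover have "p ` U \<subseteq> p ` E" "p ` E \<subseteq> W" using U by auto
    ultimately show "\<exists>U V. openin S U \<and> V \<in> (`) p ` \<B> \<and> \<one>\<^bsub>K\<^esub> \<in> U \<and> U \<subseteq> V \<and> V \<subseteq> W"
      using U by blast
  qed
qed

lemma continuous_endomorphism_image: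
  assumes f: "continuous_endomorphism G T f"
    and semiconj: "\<And>x. x \<in> carrier G \<Longrightarrow> g (p x) = p (f x)"
  shows "continuous_endomorphism K S g"
proof -
  from f have f_hom: "f \<in> hom G G" and f_cont: "continuous_map T T f"
    by (auto simp: continuous_endomorphism_def)
  have f_closed: "f x \<in> carrier G" if "x \<in> carrier G" for x
    using f_hom that by (rule hom_in_carrier)
  have "g \<in> hom K K"
  proof (rule homI)
    fix a assume "a \<in> carrier K"
    then obtain x where x: "x \<in> carrier G" "a = p x" using image_eq by blast
    then show "g a \<in> carrier K" by (simp add: semiconj f_closed)
    fix b assume "b \<in> carrier K"
    then obtain y where y: "y \<in> carrier G" "b = p y" using image_eq by blast
    have "g (a \<otimes>\<^bsub>K\<^esub> b) = p (f (x \<otimes> y))"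
      using x y semiconj[of "x \<otimes> y"] by simp
    also have "\<dots> = g a \<otimes>\<^bsub>K\<^esub> g b"
      using x y by (simp add: Group.hom_mult[OF f_hom] semiconj f_closed)
    finally show "g (a \<otimes>\<^bsub>K\<^esub> b) = g a \<otimes>\<^bsub>K\<^esub> g b" .
  qed
  moreover have "continuous_map T S (g \<circ> p)"
    by (rule continuous_map_eq[OF continuous_map_compose[OF f_cont continuous_hom]])
      (simp add: topspace_eq semiconj)
  then have "continuous_map S S g"
    using continuous_compose_quotient_map_eq[OF quotient_map_hom] by blast
  ultimately show ?thesis by (simp add: continuous_endomorphism_def)
qed

end


section \<open>Lifting pseudo-orbits\<close>

text \<open>The lift is built by \<open>x\<^sub>n\<^sub>+\<^sub>1 = d\<inverse> f(x\<^sub>n)\<close> with \<open>d \<in> D\<close> over \<open>g(y\<^sub>n) y\<^sub>n\<^sub>+\<^sub>1\<inverse>\<close>: the error of the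
  lift at \<open>n\<close> is then \<open>d\<close> itself, and \<open>p\<close> maps \<open>x\<^sub>n\<^sub>+\<^sub>1\<close> to \<open>y\<^sub>n\<^sub>+\<^sub>1 g(y\<^sub>n)\<inverse> g(y\<^sub>n) = y\<^sub>n\<^sub>+\<^sub>1\<close>.\<close>

lemma (in group_hom) pseudo_orbit_lift:
  assumes f_closed: "\<And>x. x \<in> carrier G \<Longrightarrow> f x \<in> carrier G"
    and semiconj: "\<And>x. x \<in> carrier G \<Longrightarrow> g (h x) = h (f x)"
    and surj: "h ` carrier G = carrier H"
    and D: "D \<subseteq> carrier G"
    and y: "pseudo_orbit H g (h ` D) y"
  obtains x where "pseudo_orbit G f D x" "\<And>n. h (x n) = y n"
proof -
  from y have yH: "y n \<in> carrier H" and yD: "g (y n) \<otimes>\<^bsub>H\<^esub> inv\<^bsub>H\<^esub> y (Suc n) \<in> h ` D" for n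
    by (auto simp: pseudo_orbit_def)
  have "\<exists>x. \<forall>n. (x n \<in> carrier G \<and> h (x n) = y n) \<and> f (x n) \<otimes> inv x (Suc n) \<in> D"
  proof (rule dependent_nat_choice[where P = "\<lambda>n x. x \<in> carrier G \<and> h x = y n"
        and Q = "\<lambda>n a b. f a \<otimes> inv b \<in> D"])
    show "\<exists>x. x \<in> carrier G \<and> h x = y 0" using yH[of 0] unfolding surj[symmetric] by auto
  next
    fix a n assume a: "a \<in> carrier G \<and> h a = y n"
    obtain d where d: "d \<in> D" "h d = g (y n) \<otimes>\<^bsub>H\<^esub> inv\<^bsub>H\<^esub> y (Suc n)" using yD[of n] by (metis imageE)
    have dG: "d \<in> carrier G" using d D by blast
    have fa: "f a \<in> carrier G" using a f_closed by blast
    have gy: "g (y n) = h (f a)" using a semiconj by metis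
    have "h (inv d \<otimes> f a) = inv\<^bsub>H\<^esub> (h (f a) \<otimes>\<^bsub>H\<^esub> inv\<^bsub>H\<^esub> y (Suc n)) \<otimes>\<^bsub>H\<^esub> h (f a)"
      using dG fa d gy by simp
    also have "\<dots> = y (Suc n)"
      using fa yH by (simp add: H.inv_mult_group H.m_assoc)
    finally have "h (inv d \<otimes> f a) = y (Suc n)" .
    moreover have "f a \<otimes> inv (inv d \<otimes> f a) = d"
      using fa dG by (simp add: G.inv_mult_group G.m_assoc[symmetric])
    ultimately show "\<exists>b. (b \<in> carrier G \<and> h b = y (Suc n)) \<and> f a \<otimes> inv b \<in> D"
      using dG fa d by (intro exI[of _ "inv d \<otimes> f a"]) simp
  qed
  then show thesis using that by (auto simp: pseudo_orbit_def)
qed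

lemma (in group_hom) shadowed_by_image:
  assumes f_closed: "\<And>x. x \<in> carrier G \<Longrightarrow> f x \<in> carrier G"
    and semiconj: "\<And>x. x \<in> carrier G \<Longrightarrow> g (h x) = h (f x)"
    and q: "q \<in> carrier G"
    and x: "\<And>n. x n \<in> carrier G"
    and shadow: "shadowed_by G f E x q"
  shows "shadowed_by H g (h ` E) (\<lambda>n. h (x n)) (h q)"
proof -
  have iter: "(f ^^ n) q \<in> carrier G \<and> (g ^^ n) (h q) = h ((f ^^ n) q)" for n
    by (induction n) (auto simp: q f_closed semiconj)
  have "(g ^^ n) (h q) \<otimes>\<^bsub>H\<^esub> inv\<^bsub>H\<^esub> h (x n) = h ((f ^^ n) q \<otimes> inv x n)" for n
    using iter x by simp
  then show ?thesis using shadow by (simp add: shadowed_by_def)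
qed

lemma (in open_epimorphism) shadowing_property_image:
  assumes shadowing: "shadowing_property G T \<B> f"
    and semiconj: "\<And>x. x \<in> carrier G \<Longrightarrow> g (p x) = p (f x)"
  shows "shadowing_property K S ((`) p ` \<B>) g"
proof -
  from shadowing have \<B>: "fundamental_system G T \<B>" and f: "continuous_endomorphism G T f"
    and tracing: "\<And>E. E \<in> \<B> \<Longrightarrow>
      \<exists>D\<in>\<B>. \<forall>x. pseudo_orbit G f D x \<longrightarrow> (\<exists>q\<in>carrier G. shadowed_by G f E x q)"
    by (auto simp: shadowing_property_def)
  have f_closed: "f x \<in> carrier G" if "x \<in> carrier G" for x
    using f that by (auto simp: continuous_endomorphism_def intro: hom_in_carrier)
  have "\<exists>D\<in>(`) p ` \<B>. \<forall>y. pseudo_orbit K g D y \<longrightarrow> (\<exists>q\<in>carrier K. shadowed_by K g (p ` E) y q)"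
    if E: "E \<in> \<B>" for E
  proof -
    obtain D where D: "D \<in> \<B>"
      and trace: "\<And>x. pseudo_orbit G f D x \<Longrightarrow> \<exists>q\<in>carrier G. shadowed_by G f E x q"
      using tracing[OF E] by blast
    have DG: "D \<subseteq> carrier G" using D \<B> by (auto simp: fundamental_system_def)
    have "\<exists>q\<in>carrier K. shadowed_by K g (p ` E) y q" if y: "pseudo_orbit K g (p ` D) y" for y
    proof -
      obtain x where x: "pseudo_orbit G f D x" and xy: "\<And>n. p (x n) = y n"
        using pseudo_orbit_lift[where f = f and g = g, OF f_closed semiconj image_eq DG y] by blast
      obtain q where q: "q \<in> carrier G" "shadowed_by G f E x q" using trace[OF x] by blast
      have "shadowed_by K g (p ` E) (\<lambda>n. p (x n)) (p q)"
        using x by (intro shadowed_by_image[where f = f] f_closed semiconj q)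
          (auto simp: pseudo_orbit_def)
      then show ?thesis using q by (auto simp: xy)
    qed
    then show ?thesis using D by blast
  qed
  then show ?thesis
    unfolding shadowing_property_def
    using topological_group_image fundamental_system_image[OF \<B>]
      continuous_endomorphism_image[OF f semiconj] by blast
qed


section \<open>The quotient projection\<close>

text \<open>The saturation of \<open>U\<close> is the union of the translates \<open>h U\<close> with \<open>h \<in> H\<close>. Each of them is open,
  being the preimage of \<open>U\<close> under left translation by \<open>h\<inverse>\<close>; running over all \<open>h\<close>, the inverse may
  be dropped.\<close>

lemma (in topological_group) open_map_quotient_proj:
  assumes "subgroup H G"
  shows "open_map T (quotient_topology G T H) (quotient_proj G H)"
  unfolding open_map_def
proof (intro allI impI)
  fix U assume U: "openin T U"
  interpret H: subgroup H G by fact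
  have UG: "U \<subseteq> carrier G" using openin_subset[OF U] by (simp add: topspace_eq)
  have translation: "continuous_map T T (\<lambda>x. h \<otimes> x)" if "h \<in> H" for h
  proof -
    have "continuous_map T (prod_topology T T) (\<lambda>x. (h, x))"
      using that by (intro continuous_map_pairedI) (auto simp: topspace_eq)
    from continuous_map_compose[OF this continuous_mult] show ?thesis by (simp add: o_def)
  qed
  have "{x \<in> topspace T. quotient_proj G H x \<in> quotient_proj G H ` U}
      = (\<Union>h\<in>H. {x \<in> topspace T. h \<otimes> x \<in> U})"
  proof (intro equalityI subsetI)
    fix x assume "x \<in> {x \<in> topspace T. quotient_proj G H x \<in> quotient_proj G H ` U}"
    then obtain u where x: "x \<in> carrier G" and u: "u \<in> U" "H #> x = H #> u"
      by (auto simp: topspace_eq quotient_proj_def)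
    have "u \<in> H #> x" using u UG rcos_self[OF _ assms] by auto
    then show "x \<in> (\<Union>h\<in>H. {x \<in> topspace T. h \<otimes> x \<in> U})"
      using x u by (auto simp: r_coset_def topspace_eq)
  next
    fix x assume "x \<in> (\<Union>h\<in>H. {x \<in> topspace T. h \<otimes> x \<in> U})"
    then obtain h where h: "h \<in> H" "h \<otimes> x \<in> U" and x: "x \<in> carrier G"
      by (auto simp: topspace_eq)
    then have "h \<otimes> x \<in> H #> x" by (auto simp: r_coset_def)
    then have "H #> x = H #> (h \<otimes> x)" using repr_independence[OF _ x assms] by blast
    then show "x \<in> {x \<in> topspace T. quotient_proj G H x \<in> quotient_proj G H ` U}"
      using h x by (auto simp: quotient_proj_def topspace_eq)
  qed
  also have "openin T \<dots>"
    using openin_continuous_map_preimage[OF translation U] by blast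
  finally show "openin (quotient_topology G T H) (quotient_proj G H ` U)"
    using UG by (auto simp: openin_quotient_topology quotient_proj_def FactGroup_def RCOSETS_def)
qed

lemma (in topological_group) open_epimorphism_quotient_proj:
  assumes "H \<lhd> G"
  shows "open_epimorphism G (G Mod H) (quotient_proj G H) T (quotient_topology G T H)"
proof -
  interpret normal H G by fact
  have "group_hom G (G Mod H) (quotient_proj G H)"
    unfolding group_hom_def group_hom_axioms_def quotient_proj_def
    using is_group factorgroup_is_group r_coset_hom_Mod by blast
  moreover have quot: "quotient_map T (quotient_topology G T H) (quotient_proj G H)"
    by (rule quotient_map_quotient_proj[OF topspace_eq])
  moreover have "quotient_proj G H ` carrier G = carrier (G Mod H)"
    by (auto simp: quotient_proj_def FactGroup_def RCOSETS_def)
  moreover have "topspace (quotient_topology G T H) = quotient_proj G H ` carrier G"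
    using quotient_imp_surjective_map[OF quot] by (simp add: topspace_eq)
  ultimately show ?thesis
    by (intro open_epimorphism.intro open_epimorphism_axioms.intro topological_group_axioms
        open_map_quotient_proj subgroup_axioms quotient_imp_continuous_map) auto
qed

theorem theorem3p6:
  fixes G :: "('a, 'b) monoid_scheme" and T :: "'a topology" and \<B> :: "'a set set"
    and f :: "'a \<Rightarrow> 'a" and H :: "'a set"
  assumes "comm_group G"
    and "topological_group G T"
    and "compact_space T"
    and "fundamental_system G T \<B>"
    and "continuous_endomorphism G T f"
    and "shadowing_property G T \<B> f"
    and "subgroup H G"
    and "closedin T H"
    and "f ` H \<subseteq> H"
  shows "shadowing_property (G Mod H) (quotient_topology G T H) (quotient_system G H \<B>)
           (canonical_map G H f)"
proof -
  have "H \<lhd> G" using comm_group.subgroup_imp_normal assms(1,7) by blast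
  then interpret open_epimorphism G "G Mod H" "quotient_proj G H" T "quotient_topology G T H"
    by (rule topological_group.open_epimorphism_quotient_proj[OF assms(2)])
  have "canonical_map G H f (quotient_proj G H x) = quotient_proj G H (f x)"
    if "x \<in> carrier G" for x
    using assms that
    by (intro canonical_map_quotient_proj) (auto simp: continuous_endomorphism_def)
  then show ?thesis
    unfolding quotient_system_def by (rule shadowing_property_image[OF assms(6)])
qed

end
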